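(* Let $\mathcal{N}$ be a set of names, $T$ the set of finite unordered unranked edge-labelled trees over $\mathcal{N}$, and $Op'=\{Nop(),\ Add(p,n),\ Del_2(p,n): p\in\mathcal{P},\ n\in\mathcal{N}\}$ (described below). There exists a function $IT:Op'\times Op'\to Op'$ satisfying both TP1: for every $t\in T$ and all $op_1,op_2\in Op'$, $IT(op_2,op_1)(op_1(t))=IT(op_1,op_2)(op_2(t))$; and TP2: for all $op,op_1,op_2\in Op'$, $IT(IT(op,op_1),IT(op_2,op_1))=IT(IT(op,op_2),IT(op_1,op_2))$.
   Context: Trees: $T::=\{\}\mid\{n_1(T),\dots,n_m(T)\}$ with $n_i\in\mathcal{N}$ and $n_i\neq n_j$ for $i\neq j$; trees are unordered (invariant under permutation of the listed children). $Dom(t)$ is the set of labels of the top-level edges of $t$. A path is a finite sequence of names; $\epsilon$ is the empty path, $p.p'$ concatenation, $\mathcal{P}$ the set of paths. $Nop()(t)=t$. $Add(p,n)$: $Add(n'.p,n)(\{n_1(t_1),\dots,n_q(t_q)\})=\{n_1(t_1),\dots,n_q(t_q),n'(Add(p,n)(\{\}))\}$ if $n'\notin Dom(t)$; $Add(n_i.p,n)(\{\dots,n_i(t_i),\dots\})=\{\dots,n_i(Add(p,n)(t_i)),\dots\}$; $Add(\epsilon,n)(t)=t$ if $n\in Dom(t)$; $Add(\epsilon,n)(\{n_1(t_1),\dots,n_q(t_q)\})=\{n_1(t_1),\dots,n_q(t_q),n(\{\})\}$ otherwise. $Del_2(p,n)$ deletes the whole subtree reached by the edge labelled $n$ at the end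 of path $p$: $Del_2(n'.p,n)(t)=t$ if $n'\notin Dom(t)$; $Del_2(n_i.p,n)(\{\dots,n_i(t_i),\dots\})=\{\dots,n_i(Del_2(p,n)(t_i)),\dots\}$; $Del_2(\epsilon,n)(t)=t$ if $n\notin Dom(t)$; $Del_2(\epsilon,n_i)(\{n_1(t_1),\dots,n_i(t_i),\dots,n_q(t_q)\})=\{n_1(t_1),\dots,n_{i-1}(t_{i-1}),n_{i+1}(t_{i+1}),\dots,n_q(t_q)\}$. *)

theory Defs
  imports Main "HOL-Library.Finite_Map"
begin

text \<open>
  A tree is a finite set of labelled edges with pairwise distinct labels, each leading to a
  subtree. This is exactly a finite partial map from names to subtrees, which
  makes equality of trees insensitive to the order of the children. The set of names is the
  type \<^typ>\<open>'n\<close>; it may be finite or infinite.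
\<close>

datatype 'n tree = Tree (children: "('n, 'n tree) fmap")

abbreviation empty_tree :: "'n tree" where
  "empty_tree \<equiv> Tree fmempty"

definition Dom :: "'n tree \<Rightarrow> 'n set" where
  "Dom t = fmdom' (children t)"

type_synonym 'n path = "'n list"

text \<open>
  If \<open>n'\<close> already labels an edge, \<^const>\<open>fmupd\<close> replaces the subtree below that edge; otherwise
  it adds a new edge. A missing path is created by \<open>add\<close>, whereas \<open>del\<close> then does nothing.
\<close>

primrec add :: "'n path \<Rightarrow> 'n \<Rightarrow> 'n tree \<Rightarrow> 'n tree" where
  "add [] n t =
    (if n \<in> Dom t then t else Tree (fmupd n empty_tree (children t)))"
| "add (n' # p) n t =
    (case fmlookup (children t) n' of
       None \<Rightarrow> Tree (fmupd n' (add p n empty_tree) (children t))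
     | Some s \<Rightarrow> Tree (fmupd n' (add p n s) (children t)))"

primrec del :: "'n path \<Rightarrow> 'n \<Rightarrow> 'n tree \<Rightarrow> 'n tree" where
  "del [] n t =
    (if n \<in> Dom t then Tree (fmdrop n (children t)) else t)"
| "del (n' # p) n t =
    (case fmlookup (children t) n' of
       None \<Rightarrow> t
     | Some s \<Rightarrow> Tree (fmupd n' (del p n s) (children t)))"

text \<open>
  Operations are syntactic objects, so equality of operations is equality of
  constructor and arguments.
\<close>

datatype 'n operation = Nop | Add "'n path" 'n | Del "'n path" 'n

primrec app :: "'n operation \<Rightarrow> 'n tree \<Rightarrow> 'n tree" where
  "app Nop t = t"
| "app (Add p n) t = add p n t"
| "app (Del p n) t = del p n t"

definition TP1 :: "('n operation \<times> 'n operation \<Rightarrow> 'n operation) \<Rightarrow> bool" where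
  "TP1 IT \<longleftrightarrow>
    (\<forall>t op1 op2. app (IT (op2, op1)) (app op1 t) = app (IT (op1, op2)) (app op2 t))"

definition TP2 :: "('n operation \<times> 'n operation \<Rightarrow> 'n operation) \<Rightarrow> bool" where
  "TP2 IT \<longleftrightarrow>
    (\<forall>op op1 op2. IT (IT (op, op1), IT (op2, op1)) = IT (IT (op, op2), IT (op1, op2)))"

end

theory Submission
  imports Defs "HOL-Library.Sublist"
begin

text \<open>
  A tree is determined by its prefix-closed set of paths. Writing \<open>q = p @ [n]\<close>, the operation
  \<open>Add p n\<close> inserts all prefixes of \<open>q\<close> and \<open>Del p n\<close> removes all extensions of \<open>q\<close>. These
  commute except for an addition of \<open>q\<close> against a deletion of a prefix \<open>r\<close> of \<open>q\<close>, where the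
  deletion must win: the addition is cut down to the parent of \<open>r\<close>, which the original addition
  would have created too. Cutting \<open>q\<close> at \<open>r\<close> yields the longest prefix of \<open>q\<close> that does not
  extend \<open>r\<close>, so cuts at several paths commute, and this gives TP2.
\<close>

primrec has_path :: "'n path \<Rightarrow> 'n tree \<Rightarrow> bool" where
  "has_path [] t \<longleftrightarrow> True"
| "has_path (n # q) t \<longleftrightarrow>
    (case fmlookup (children t) n of None \<Rightarrow> False | Some s \<Rightarrow> has_path q s)"

text \<open>Reduces TP1 to comparing path sets. One-element paths detect the labels at the root;
  longer ones feed the induction hypothesis.\<close>

lemma tree_eqI:
  assumes "\<And>q. has_path q t = has_path q u"
  shows "t = u"
  using assms
proof (induction t arbitrary: u)
  case (Tree m)
  have "fmlookup m n = fmlookup (children u) n" for n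
  proof (cases "fmlookup m n")
    case None
    then show ?thesis
      using Tree.prems[of "[n]"] by (auto split: option.splits)
  next
    case (Some s)
    then obtain s' where s': "fmlookup (children u) n = Some s'"
      using Tree.prems[of "[n]"] by (auto split: option.splits)
    have "has_path q s = has_path q s'" for q
      using Tree.prems[of "n # q"] Some s' by simp
    with Tree.IH[OF fmran'I[OF Some]] Some s' show ?thesis
      by simp
  qed
  then show ?case
    by (cases u) (auto intro: fmap_ext)
qed

lemma has_path_empty_tree: "has_path q empty_tree \<longleftrightarrow> q = []"
  by (cases q) auto

lemma has_path_add: "has_path q (add p n t) \<longleftrightarrow> has_path q t \<or> prefix q (p @ [n])"
proof (induction p arbitrary: q t)
  case Nil
  then show ?case
    by (cases q) (auto simp: Dom_def has_path_empty_tree fmlookup_dom'_iff split: option.splits)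
next
  case (Cons a p)
  then show ?case
    by (cases q) (auto simp: has_path_empty_tree split: option.splits)
qed

lemma has_path_del: "has_path q (del p n t) \<longleftrightarrow> has_path q t \<and> \<not> prefix (p @ [n]) q"
proof (induction p arbitrary: q t)
  case Nil
  then show ?case
    by (cases q) (auto simp: Dom_def fmlookup_dom'_iff split: option.splits)
next
  case (Cons a p)
  then show ?case
    by (cases q) (auto split: option.splits)
qed

text \<open>A cut may leave the empty path, which every tree has, so adding it is
  \<open>Nop\<close>.\<close>

definition add_at :: "'n path \<Rightarrow> 'n operation" where
  "add_at q = (if q = [] then Nop else Add (butlast q) (last q))"

lemma add_at_Nil: "add_at [] = Nop"
  by (simp add: add_at_def)

lemma add_at_snoc: "add_at (p @ [n]) = Add p n"
  by (simp add: add_at_def)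

lemma add_at_neq_Del: "add_at q \<noteq> Del p n"
  by (simp add: add_at_def)

lemma has_path_add_at: "has_path q (app (add_at r) t) \<longleftrightarrow> has_path q t \<or> prefix q r"
  by (cases r rule: rev_cases) (auto simp: add_at_Nil add_at_snoc has_path_add)

definition cut :: "'n path \<Rightarrow> 'n path \<Rightarrow> 'n path" where
  "cut r q = (if prefix r q then butlast r else q)"

text \<open>If \<open>r\<close> is a prefix of \<open>q\<close>, all prefixes of \<open>q\<close>
  are comparable with \<open>r\<close>, so those not extending \<open>r\<close> are its proper
  prefixes.\<close>

lemma prefix_cut:
  assumes "r \<noteq> []"
  shows "prefix x (cut r q) \<longleftrightarrow> prefix x q \<and> \<not> prefix r x"
proof -
  have "prefix x (butlast r) \<longleftrightarrow> prefix x r \<and> x \<noteq> r"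
    using assms by (cases r rule: rev_cases) auto
  then show ?thesis
    using prefix_order.trans[of x r q] prefix_order.trans[of r x q]
      prefix_same_cases[of x q r] prefix_order.antisym[of x r]
    by (auto simp: cut_def)
qed

text \<open>A path is determined by its prefixes, and \<open>prefix_cut\<close> describes those of
  both sides symmetrically in \<open>r\<close> and \<open>s\<close>.\<close>

lemma cut_commute:
  assumes "r \<noteq> []" "s \<noteq> []"
  shows "cut r (cut s q) = cut s (cut r q)"
proof -
  have "prefix x (cut r (cut s q)) \<longleftrightarrow> prefix x (cut s (cut r q))" for x
    using assms by (auto simp: prefix_cut)
  then show ?thesis
    by (meson prefix_order.antisym prefix_order.refl)
qed

fun transform :: "'n operation \<times> 'n operation \<Rightarrow> 'n operation" where
  "transform (Add p n, Del p' n') = add_at (cut (p' @ [n']) (p @ [n]))"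
| "transform (op, _) = op"

text \<open>Lets cuts compose even after an addition has shrunk to \<open>Nop\<close>: a nonempty
  path is no prefix of \<open>[]\<close>.\<close>

lemma transform_add_at_Del: "transform (add_at q, Del p n) = add_at (cut (p @ [n]) q)"
  by (cases q rule: rev_cases) (auto simp: add_at_Nil add_at_snoc cut_def)

lemma transform_add_at_other:
  assumes "\<And>p n. op \<noteq> Del p n"
  shows "transform (add_at q, op) = add_at q"
  using assms by (cases q rule: rev_cases; cases op) (auto simp: add_at_Nil add_at_snoc)

lemma transform_Del: "transform (Del p n, op) = Del p n"
  by (cases op) auto

lemma transform_Nop: "transform (Nop, op) = Nop"
  by (cases op) auto

lemma transform_eq_Del_iff: "transform (op, op') = Del p n \<longleftrightarrow> op = Del p n"
  by (cases "(op, op')" rule: transform.cases) (auto simp: add_at_neq_Del)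

lemma TP1_transform: "TP1 transform"
  unfolding TP1_def
proof (intro allI)
  fix t :: "'n tree" and op1 op2
  show "app (transform (op2, op1)) (app op1 t) = app (transform (op1, op2)) (app op2 t)"
  proof (rule tree_eqI)
    fix q
    show "has_path q (app (transform (op2, op1)) (app op1 t)) =
      has_path q (app (transform (op1, op2)) (app op2 t))"
      \<comment> \<open>For an addition against a deletion, both orders leave the old or added paths
        that do not extend the deleted one.\<close>
      by (cases op1; cases op2)
        (auto simp: has_path_add has_path_del has_path_add_at prefix_cut)
  qed
qed

lemma TP2_transform: "TP2 transform"
  unfolding TP2_def
proof (intro allI)
  fix op op1 op2 :: "'n operation"
  show "transform (transform (op, op1), transform (op2, op1)) =
    transform (transform (op, op2), transform (op1, op2))"
  proof (cases op)
    case (Add p n)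
    have op: "op = add_at (p @ [n])"
      by (simp add: Add add_at_snoc)
    \<comment> \<open>Only deletions alter an addition, and transforming \<open>op'\<close> cannot
      turn it into one.\<close>
    have other: "transform (add_at q, transform (op', op'')) = add_at q"
      if "\<And>p n. op' \<noteq> Del p n" for q :: "'n path" and op' op'' :: "'n operation"
      using that by (intro transform_add_at_other) (simp add: transform_eq_Del_iff)
    show ?thesis
      unfolding op
      by (cases op1; cases op2)
        (simp_all add: other transform_add_at_other transform_add_at_Del transform_Del
          add_at_neq_Del cut_commute)
  qed (simp_all add: transform_Nop transform_Del)
qed

theorem theorem3:
  "\<exists>IT :: 'n operation \<times> 'n operation \<Rightarrow> 'n operation. TP1 IT \<and> TP2 IT"
  using TP1_transform TP2_transform by blast

end
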